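(* Let $\Delta=\alpha_1\vee\cdots\vee\alpha_n$ be a DNF and let $\ell$ be a literal. Then the DNF obtained by removing literal $\ell$ from every term $\alpha_i$ of $\Delta$ is logically equivalent to $\exists \ell\cdot\Delta$. Moreover, if $\Delta$ is closed under consensus on the variable of literal $\ell$, then the DNF obtained by removing from $\Delta$ every term $\alpha_i$ that contains literal $\bar{\ell}$ is logically equivalent to $\forall \ell\cdot\Delta$.
   Context: A literal of Boolean variable $X$ is $x$ or $\bar{x}$; $\bar{\ell}$ denotes the complement of literal $\ell$. A term is a set of literals over distinct variables, read as the conjunction of its literals (the empty term is true). A DNF is a finite set of terms, read as their disjunction. The consensus of terms $x\wedge\alpha$ and $\bar{x}\wedge\beta$ on variable $X$ leads to the term $\alpha\wedge\beta$ when $\alpha$ and $\beta$ share no complementary literals. A DNF is closed under consensus on variable $X$ iff the result of each such consensus on $X$ between terms of the DNF is in the DNF. Conditioning: $\varphi|x$ (resp. $\varphi|\bar{x}$) is obtained by replacing every occurrence of variable $X$ in $\varphi$ with true (resp. false). Literal quantification is defined by $\forall \ell\cdot\varphi = (\ell\vee(\varphi|\bar{\ell}))\wedge(\varphi|\ell)$ and $\exists \ell\cdot\varphi=(\varphi|\ell)\vee(\bar{\ell}\wedge(\varphi|\bar{\ell}))$. *)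

theory Defs
  imports "HOL-Library.FSet"
begin

datatype 'v literal = Pos 'v | Neg 'v

primrec var_of :: "'v literal \<Rightarrow> 'v" where
  "var_of (Pos X) = X"
| "var_of (Neg X) = X"

primrec compl :: "'v literal \<Rightarrow> 'v literal" where
  "compl (Pos X) = Neg X"
| "compl (Neg X) = Pos X"

datatype 'v form =
    TrueF
  | FalseF
  | VarF 'v
  | NotF "'v form"
  | ConjF "'v form fset"
  | DisjF "'v form fset"

text \<open>
  Recursion through a finite set goes via its image, so below the two quantified formulas say
  that all, respectively some, members of \<open>F\<close> hold under the assignment \<open>I\<close>.
\<close>

primrec sat :: "('v \<Rightarrow> bool) \<Rightarrow> 'v form \<Rightarrow> bool" where
  "sat I TrueF = True"
| "sat I FalseF = False"
| "sat I (VarF X) = I X"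
| "sat I (NotF f) = (\<not> sat I f)"
| "sat I (ConjF F) = fBall (sat I |`| F) (\<lambda>b. b)"
| "sat I (DisjF F) = fBex (sat I |`| F) (\<lambda>b. b)"

definition equivalent :: "'v form \<Rightarrow> 'v form \<Rightarrow> bool" where
  "equivalent f g \<longleftrightarrow> (\<forall>I. sat I f = sat I g)"

primrec subst :: "'v \<Rightarrow> 'v form \<Rightarrow> 'v form \<Rightarrow> 'v form" where
  "subst X g TrueF = TrueF"
| "subst X g FalseF = FalseF"
| "subst X g (VarF Y) = (if Y = X then g else VarF Y)"
| "subst X g (NotF f) = NotF (subst X g f)"
| "subst X g (ConjF F) = ConjF (subst X g |`| F)"
| "subst X g (DisjF F) = DisjF (subst X g |`| F)"

primrec condition :: "'v form \<Rightarrow> 'v literal \<Rightarrow> 'v form" where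
  "condition f (Pos X) = subst X TrueF f"
| "condition f (Neg X) = subst X FalseF f"

primrec lit_form :: "'v literal \<Rightarrow> 'v form" where
  "lit_form (Pos X) = VarF X"
| "lit_form (Neg X) = NotF (VarF X)"

definition forall_lit :: "'v literal \<Rightarrow> 'v form \<Rightarrow> 'v form" where
  "forall_lit l f =
     ConjF {| DisjF {| lit_form l, condition f (compl l) |}, condition f l |}"

definition exists_lit :: "'v literal \<Rightarrow> 'v form \<Rightarrow> 'v form" where
  "exists_lit l f =
     DisjF {| condition f l, ConjF {| lit_form (compl l), condition f (compl l) |} |}"

definition is_term :: "'v literal fset \<Rightarrow> bool" where
  "is_term t \<longleftrightarrow> (\<forall>l m. l |\<in>| t \<and> m |\<in>| t \<and> l \<noteq> m \<longrightarrow> var_of l \<noteq> var_of m)"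

definition is_dnf :: "'v literal fset fset \<Rightarrow> bool" where
  "is_dnf D \<longleftrightarrow> (\<forall>t. t |\<in>| D \<longrightarrow> is_term t)"

definition term_form :: "'v literal fset \<Rightarrow> 'v form" where
  "term_form t = ConjF (lit_form |`| t)"

definition dnf_form :: "'v literal fset fset \<Rightarrow> 'v form" where
  "dnf_form D = DisjF (term_form |`| D)"

text \<open>
  \<open>consensus X s t r\<close> is a relation because the consensus is undefined when the remainders
  of \<open>s\<close> and \<open>t\<close> share complementary literals.
\<close>

definition consensus ::
  "'v \<Rightarrow> 'v literal fset \<Rightarrow> 'v literal fset \<Rightarrow> 'v literal fset \<Rightarrow> bool" where
  "consensus X s t r \<longleftrightarrow>
     (\<exists>a b. Pos X |\<notin>| a \<and> s = finsert (Pos X) a \<and>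
            Neg X |\<notin>| b \<and> t = finsert (Neg X) b \<and>
            (\<forall>m. m |\<in>| a \<longrightarrow> compl m |\<notin>| b) \<and>
            r = a |\<union>| b)"

definition closed_under_consensus :: "'v \<Rightarrow> 'v literal fset fset \<Rightarrow> bool" where
  "closed_under_consensus X D \<longleftrightarrow>
     (\<forall>s t r. s |\<in>| D \<and> t |\<in>| D \<and> consensus X s t r \<longrightarrow> r |\<in>| D)"

definition remove_literal :: "'v literal \<Rightarrow> 'v literal fset fset \<Rightarrow> 'v literal fset fset" where
  "remove_literal l D = (\<lambda>t. t |-| {|l|}) |`| D"

definition remove_terms_with :: "'v literal \<Rightarrow> 'v literal fset fset \<Rightarrow> 'v literal fset fset" where
  "remove_terms_with l D = ffilter (\<lambda>t. l |\<notin>| t) D"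

lemma is_dnf_removal:
  assumes "is_dnf D"
  shows "is_dnf (remove_literal l D)" and "is_dnf (remove_terms_with l D)"
  using assms by (auto simp: is_dnf_def is_term_def remove_literal_def remove_terms_with_def)

end

theory Submission
  imports Defs
begin

text \<open>
  Conditioning on \<open>l\<close> evaluates the formula under the assignment modified to make \<open>l\<close> true, so
  both claims compare the terms true under an assignment \<open>I\<close> with those true under its
  modifications. The only case that needs closure under consensus is an \<open>I\<close> falsifying \<open>l\<close> for
  which all true terms contain the complement of \<open>l\<close>, while all terms true after flipping \<open>I\<close> at
  \<open>l\<close> contain \<open>l\<close>: the consensus of two such terms exists, since \<open>I\<close> satisfies both remainders,
  and it is true under \<open>I\<close>.
\<close>

primrec make_true :: "'v literal \<Rightarrow> ('v \<Rightarrow> bool) \<Rightarrow> 'v \<Rightarrow> bool" where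
  "make_true (Pos X) I = I(X := True)"
| "make_true (Neg X) I = I(X := False)"

abbreviation holds :: "('v \<Rightarrow> bool) \<Rightarrow> 'v literal \<Rightarrow> bool" where
  "holds I m \<equiv> sat I (lit_form m)"

abbreviation sat_term :: "('v \<Rightarrow> bool) \<Rightarrow> 'v literal fset \<Rightarrow> bool" where
  "sat_term I t \<equiv> \<forall>m. m |\<in>| t \<longrightarrow> holds I m"

lemma compl_compl [simp]: "compl (compl l) = l"
  by (cases l) auto

lemma compl_neq [simp]: "compl l \<noteq> l"
  by (cases l) auto

lemma var_of_compl [simp]: "var_of (compl l) = var_of l"
  by (cases l) auto

lemma holds_compl [simp]: "holds I (compl l) \<longleftrightarrow> \<not> holds I l"
  by (cases l) auto

lemma holds_make_true: "holds (make_true l I) m \<longleftrightarrow> m = l \<or> m \<noteq> compl l \<and> holds I m"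
  by (cases l; cases m) auto

lemma make_true_idem: "holds I l \<Longrightarrow> make_true l I = I"
  by (cases l) (auto simp: fun_eq_iff)

lemma sat_subst: "sat I (subst X g f) = sat (I(X := sat I g)) f"
  by (induction f) auto

lemma sat_condition: "sat I (condition f l) = sat (make_true l I) f"
  by (cases l) (auto simp: sat_subst)

lemma sat_dnf_form: "sat I (dnf_form D) \<longleftrightarrow> (\<exists>t. t |\<in>| D \<and> sat_term I t)"
  by (auto simp: dnf_form_def term_form_def)

text \<open>If \<open>l\<close> holds under \<open>I\<close>, conditioning on \<open>l\<close>
  changes nothing and the guarded disjunct is false; otherwise the guard \<open>compl l\<close>
  holds and conditioning on \<open>compl l\<close> changes nothing.\<close>

lemma sat_exists_lit:
  "sat I (exists_lit l f) \<longleftrightarrow> sat (make_true l I) f \<or> sat I f"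
proof (cases "holds I l")
  case False
  then have "make_true (compl l) I = I"
    by (intro make_true_idem) simp
  with False show ?thesis
    by (simp add: exists_lit_def sat_condition)
qed (simp add: exists_lit_def sat_condition make_true_idem)

lemma sat_forall_lit:
  "sat I (forall_lit l f) \<longleftrightarrow> sat (make_true l I) f \<and> sat I f"
proof (cases "holds I l")
  case False
  then have "make_true (compl l) I = I"
    by (intro make_true_idem) simp
  with False show ?thesis
    by (auto simp: forall_lit_def sat_condition)
qed (simp add: forall_lit_def sat_condition make_true_idem)

lemma is_term_compl_notin: "is_term t \<Longrightarrow> l |\<in>| t \<Longrightarrow> compl l |\<notin>| t"
  unfolding is_term_def by (metis compl_neq var_of_compl)

text \<open>If \<open>l\<close> is in \<open>t\<close>, then \<open>compl l\<close> is not, so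
  making \<open>l\<close> true affects no other literal of \<open>t\<close>. If \<open>l\<close> is
  not in \<open>t\<close>, removing it does nothing, and a term true once \<open>l\<close> is made
  true cannot contain \<open>compl l\<close>.\<close>

lemma sat_term_remove_literal:
  assumes "is_term t"
  shows "sat_term I (t |-| {|l|}) \<longleftrightarrow> sat_term (make_true l I) t \<or> sat_term I t"
  using is_term_compl_notin[OF assms, of l] by (auto simp: holds_make_true)

lemma equivalent_remove_literal:
  assumes "is_dnf D"
  shows "equivalent (dnf_form (remove_literal l D)) (exists_lit l (dnf_form D))"
proof -
  have "(\<exists>t. t |\<in>| remove_literal l D \<and> sat_term I t) \<longleftrightarrow>
      (\<exists>t. t |\<in>| D \<and> sat_term (make_true l I) t) \<or> (\<exists>t. t |\<in>| D \<and> sat_term I t)" for I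
  proof -
    have "(\<exists>t. t |\<in>| remove_literal l D \<and> sat_term I t) \<longleftrightarrow>
        (\<exists>t. t |\<in>| D \<and> sat_term I (t |-| {|l|}))"
      unfolding remove_literal_def by blast
    also have "\<dots> \<longleftrightarrow> (\<exists>t. t |\<in>| D \<and> (sat_term (make_true l I) t \<or> sat_term I t))"
      using assms sat_term_remove_literal[of _ l I] unfolding is_dnf_def by (metis (lifting))
    finally show ?thesis by blast
  qed
  then show ?thesis
    unfolding equivalent_def sat_exists_lit sat_dnf_form by simp
qed

text \<open>\<open>consensus\<close> fixes the polarity of its two parents. This form of closure
  allows \<open>l\<close> to have either sign.\<close>

lemma consensus_literal:
  assumes "closed_under_consensus (var_of l) D" "s |\<in>| D" "t |\<in>| D" "l |\<in>| s" "compl l |\<in>| t"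
    and "\<And>m. m |\<in>| s |-| {|l|} \<Longrightarrow> compl m |\<notin>| t |-| {|compl l|}"
  shows "(s |-| {|l|}) |\<union>| (t |-| {|compl l|}) |\<in>| D"
proof -
  let ?a = "s |-| {|l|}" and ?b = "t |-| {|compl l|}"
  have s: "s = finsert l ?a" and t: "t = finsert (compl l) ?b"
    using assms(4,5) by auto
  have l: "l |\<notin>| ?a" and cl: "compl l |\<notin>| ?b"
    by auto
  \<comment> \<open>For a negative \<open>l\<close> the parents swap roles, so the clash condition
    is needed with the remainders exchanged.\<close>
  have ba: "compl m |\<notin>| ?a" if "m |\<in>| ?b" for m
    using assms(6)[of "compl m"] that by auto
  show ?thesis
  proof (cases l)
    case (Pos X)
    have "consensus X s t (?a |\<union>| ?b)"
      unfolding consensus_def using s t l cl assms(6) Pos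
      by (intro exI[of _ ?a] exI[of _ ?b]) (metis compl.simps(1))
    with assms(1-3) Pos show ?thesis
      unfolding closed_under_consensus_def by (metis var_of.simps(1))
  next
    case (Neg X)
    have "consensus X t s (?b |\<union>| ?a)"
      unfolding consensus_def using s t l cl ba Neg
      by (intro exI[of _ ?b] exI[of _ ?a]) (metis compl.simps(2))
    with assms(1-3) Neg show ?thesis
      unfolding closed_under_consensus_def by (metis var_of.simps(2) funion_commute)
  qed
qed

lemma sat_remove_terms_with:
  assumes closed: "closed_under_consensus (var_of l) D"
    and s: "s |\<in>| D" "sat_term (make_true l I) s"
    and t: "t |\<in>| D" "sat_term I t"
  shows "\<exists>r. r |\<in>| D \<and> compl l |\<notin>| r \<and> sat_term I r"
proof -
  have cs: "compl l |\<notin>| s"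
    using s(2) by (auto simp: holds_make_true)
  have rest_s: "holds I m" if "m |\<in>| s" "m \<noteq> l" for m
    using s(2) that by (auto simp: holds_make_true)
  consider "compl l |\<notin>| t" | "l |\<notin>| s" | "compl l |\<in>| t" "l |\<in>| s" by blast
  then show ?thesis
  proof cases
    case 1
    with t show ?thesis by blast
  next
    \<comment> \<open>Here \<open>s\<close> contains neither \<open>l\<close> nor
      \<open>compl l\<close>, so its truth does not depend on the modification of
      \<open>I\<close>.\<close>
    case 2
    with s(1) cs rest_s show ?thesis by blast
  next
    case 3
    let ?r = "(s |-| {|l|}) |\<union>| (t |-| {|compl l|})"
    \<comment> \<open>A clash would make both \<open>m\<close> and \<open>compl m\<close> true under
      \<open>I\<close>.\<close>
    have "compl m |\<notin>| t" if "m |\<in>| s |-| {|l|}" for m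
      using t(2) rest_s[of m] that holds_compl[of I m] by auto
    then have "?r |\<in>| D"
      using closed s(1) t(1) 3 by (intro consensus_literal) auto
    moreover have "compl l |\<notin>| ?r"
      using cs by simp
    moreover have "sat_term I ?r"
      using t(2) rest_s by auto
    ultimately show ?thesis by blast
  qed
qed

lemma equivalent_remove_terms_with:
  assumes "closed_under_consensus (var_of l) D"
  shows "equivalent (dnf_form (remove_terms_with (compl l) D)) (forall_lit l (dnf_form D))"
proof -
  have "(\<exists>r. r |\<in>| D \<and> compl l |\<notin>| r \<and> sat_term I r) \<longleftrightarrow>
      (\<exists>s. s |\<in>| D \<and> sat_term (make_true l I) s) \<and> (\<exists>t. t |\<in>| D \<and> sat_term I t)"
    (is "?L \<longleftrightarrow> ?R") for I
  proof
    assume ?L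
    \<comment> \<open>A term without \<open>compl l\<close> that is true under \<open>I\<close>
      stays true when \<open>l\<close> is made true, so it witnesses both conjuncts.\<close>
    then show ?R unfolding holds_make_true by blast
  next
    assume ?R
    then show ?L using sat_remove_terms_with[OF assms] by blast
  qed
  then show ?thesis
    unfolding equivalent_def sat_forall_lit sat_dnf_form
    by (simp add: remove_terms_with_def conj_left_commute)
qed

theorem proposition22:
  fixes \<Delta> :: "'v literal fset fset" and l :: "'v literal"
  assumes "is_dnf \<Delta>"
  shows "equivalent (dnf_form (remove_literal l \<Delta>)) (exists_lit l (dnf_form \<Delta>)) \<and>
    (closed_under_consensus (var_of l) \<Delta> \<longrightarrow>
      equivalent (dnf_form (remove_terms_with (compl l) \<Delta>)) (forall_lit l (dnf_form \<Delta>)))"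
  using assms equivalent_remove_literal equivalent_remove_terms_with by blast

end
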